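(* For all integers $k,n\ge1$, the number $\phi(k,n;T)$ of $k\times n$ $(0,1)$-matrices avoiding $T=\begin{pmatrix}1&1\\0&0\end{pmatrix}$ is $$\phi(k,n;T)=2\sum_{l\ge1}\binom{n}{l-1}\,l^k+(n^2-n-4)\,2^{n-2}-n(n+3)\,2^{n+k-3}.$$
   Context: A $(0,1)$-matrix is a matrix with all entries in $\{0,1\}$. A $2\times2$ submatrix of a matrix is obtained by choosing two rows $i_1<i_2$ and two columns $j_1<j_2$. For a $2\times 2$ $(0,1)$-matrix $P$, let $[P]$ be its equivalence class under row exchanges and column exchanges. A $(0,1)$-matrix avoids $P$ if none of its $2\times2$ submatrices belongs to $[P]$. Here $[T]=\left\{\begin{pmatrix}1&1\\0&0\end{pmatrix},\begin{pmatrix}0&0\\1&1\end{pmatrix}\right\}$. $\phi(k,n;T)$ is the number of $k\times n$ $(0,1)$-matrices avoiding $T$. *)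

theory Defs
  imports
    "Jordan_Normal_Form.Column_Operations"
    "Jordan_Normal_Form.DL_Submatrix"
    "HOL-Analysis.Infinite_Sum"
begin

definition zero_one_mat :: "int mat \<Rightarrow> bool" where
  "zero_one_mat A \<longleftrightarrow> elements_mat A \<subseteq> {0, 1}"

text \<open>The equivalence class of a \<open>2 \<times> 2\<close> matrix under row and column exchanges.
  Indices are 0-based, and exchanges are involutions, so closing under them from \<open>P\<close> gives
  the whole class.\<close>

inductive_set exchange_class :: "int mat \<Rightarrow> int mat set" for P where
  base: "P \<in> exchange_class P"
| row_exchange: "Q \<in> exchange_class P \<Longrightarrow> swaprows 0 1 Q \<in> exchange_class P"
| col_exchange: "Q \<in> exchange_class P \<Longrightarrow> swapcols 0 1 Q \<in> exchange_class P"

definition avoids :: "int mat \<Rightarrow> int mat \<Rightarrow> bool" where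
  "avoids A P \<longleftrightarrow>
    (\<forall>i1 i2 j1 j2. i1 < i2 \<and> i2 < dim_row A \<and> j1 < j2 \<and> j2 < dim_col A \<longrightarrow>
      submatrix A {i1, i2} {j1, j2} \<notin> exchange_class P)"

definition phi :: "nat \<Rightarrow> nat \<Rightarrow> int mat \<Rightarrow> nat" where
  "phi k n P = card {A \<in> carrier_mat k n. zero_one_mat A \<and> avoids A P}"

definition T_mat :: "int mat" where
  "T_mat = mat_of_rows_list 2 [[1, 1], [0, 0]]"

lemma exchange_class_T:
  "exchange_class T_mat = {mat_of_rows_list 2 [[1, 1], [0, 0]], mat_of_rows_list 2 [[0, 0], [1, 1]]}"
    (is "_ = {?T, ?T'}")
proof
  have less_2: "i < Suc (Suc 0) \<longleftrightarrow> i = 0 \<or> i = Suc 0" for i :: nat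
    by auto
  have r: "swaprows 0 1 ?T = (?T' :: int mat)" "swaprows 0 1 ?T' = (?T :: int mat)"
    by (rule eq_matI; auto simp: mat_of_rows_list_def less_2)+
  have c: "swapcols 0 1 ?T = (?T :: int mat)" "swapcols 0 1 ?T' = (?T' :: int mat)"
    by (rule eq_matI; auto simp: mat_of_rows_list_def less_2)+
  show "exchange_class T_mat \<subseteq> {?T, ?T'}"
  proof
    fix Q assume "Q \<in> exchange_class T_mat"
    then show "Q \<in> {?T, ?T'}"
    proof induction
      case base
      then show ?case by (simp add: T_mat_def)
    next
      case (row_exchange Q)
      then show ?case using r by auto
    next
      case (col_exchange Q)
      then show ?case using c by auto
    qed
  qed
  show "{?T, ?T'} \<subseteq> exchange_class T_mat"
    using exchange_class.base[of T_mat] exchange_class.row_exchange[OF exchange_class.base, of T_mat] r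
    by (auto simp: T_mat_def)
qed

end

theory Submission
  imports Defs
begin

text \<open>
  Reading each row as the set of columns in which it has a \<open>1\<close>, a matrix avoids \<open>T\<close> exactly when any two
  rows \<open>X\<close>, \<open>Y\<close> satisfy \<open>\<bar>X - Y\<bar> \<le> 1\<close> and \<open>\<bar>Y - X\<bar> \<le> 1\<close>: two columns in \<open>X - Y\<close> are a forbidden
  submatrix. So the task is to count \<open>k\<close>-tuples of pairwise close subsets of an \<open>n\<close>-set \<open>V\<close>.

  The tuples with all entries equal number \<open>2 ^ n\<close>. The entries of any other tuple either all lie in
  one star (a set \<open>A\<close> together with its one-element extensions inside \<open>V\<close>) or all lie in one costar (a
  set \<open>B\<close> together with its one-element deletions); this is the structural step,
  \<open>close_in_star_or_costar\<close>. Two distinct members of a star intersect in its centre \<open>A\<close>, and two distinct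
  members of a costar have union \<open>B\<close>, so a nonconstant tuple determines its star and its costar.
  A star or costar with \<open>s\<close> members carries \<open>s ^ k - s\<close> nonconstant tuples, with
  \<open>s = \<bar>V - A\<bar> + 1\<close> and \<open>s = \<bar>B\<bar> + 1\<close> respectively. Summing over all \<open>A\<close> and over all \<open>B\<close>
  gives, each time, \<open>\<Sum>a. (n choose a) (a + 1) ^ k\<close> minus the same sum with exponent \<open>1\<close>.

  It remains to subtract the tuples counted twice. The star of \<open>A\<close> and the costar of \<open>B\<close> have two
  common members when \<open>A \<subseteq> B\<close> and \<open>\<bar>B - A\<bar> \<in> {1, 2}\<close>, and at most one otherwise. Each such pair thus
  accounts for \<open>2 ^ k - 2\<close> tuples, and choosing \<open>D = B - A\<close> before \<open>A\<close> shows that there are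
  \<open>n 2 ^ (n - 1) + (n choose 2) 2 ^ (n - 2)\<close> such pairs. Inclusion and exclusion then yields the formula.
\<close>

section \<open>Close sets, stars and costars\<close>

text \<open>At most one element of \<open>X\<close> is outside \<open>Y\<close>; phrased without cardinality, so that infinite sets are not
  counted as having \<open>0\<close> elements.\<close>

definition almost_subset :: "'a set \<Rightarrow> 'a set \<Rightarrow> bool" where
  "almost_subset X Y \<longleftrightarrow> (\<forall>a\<in>X - Y. \<forall>b\<in>X - Y. a = b)"

lemma almost_subsetI: "(\<And>a b. a \<in> X \<Longrightarrow> a \<notin> Y \<Longrightarrow> b \<in> X \<Longrightarrow> b \<notin> Y \<Longrightarrow> a = b) \<Longrightarrow> almost_subset X Y"
  by (simp add: almost_subset_def)

lemma almost_subsetD: "almost_subset X Y \<Longrightarrow> a \<in> X \<Longrightarrow> a \<notin> Y \<Longrightarrow> b \<in> X \<Longrightarrow> b \<notin> Y \<Longrightarrow> a = b"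
  by (simp add: almost_subset_def)

text \<open>The set \<open>A\<close> and its one-element extensions within \<open>V\<close>, provided \<open>A \<subseteq> V\<close>; see \<open>star_eq\<close>.\<close>

definition star :: "'a set \<Rightarrow> 'a set \<Rightarrow> 'a set set" where
  "star V A = {Z. A \<subseteq> Z \<and> Z \<subseteq> V \<and> almost_subset Z A}"

text \<open>The set \<open>B\<close> and its one-element deletions; see \<open>costar_eq\<close>.\<close>

definition costar :: "'a set \<Rightarrow> 'a set set" where
  "costar B = {Z. Z \<subseteq> B \<and> almost_subset B Z}"

text \<open>Quantifying over all ordered pairs of indices makes the entries close in both directions.\<close>

definition close_tuples :: "'i set \<Rightarrow> 'a set \<Rightarrow> ('i \<Rightarrow> 'a set) set" where
  "close_tuples I V = {f \<in> I \<rightarrow>\<^sub>E Pow V. \<forall>i\<in>I. \<forall>j\<in>I. almost_subset (f i) (f j)}"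

section \<open>Nonconstant tuples\<close>

definition nonconst :: "'i set \<Rightarrow> 'b set \<Rightarrow> ('i \<Rightarrow> 'b) set" where
  "nonconst I S = {f \<in> I \<rightarrow>\<^sub>E S. \<exists>i\<in>I. \<exists>j\<in>I. f i \<noteq> f j}"

lemma nonconstE:
  assumes "f \<in> nonconst I S"
  obtains i j where "f \<in> I \<rightarrow>\<^sub>E S" "i \<in> I" "j \<in> I" "f i \<in> S" "f j \<in> S" "f i \<noteq> f j"
proof -
  from assms obtain i j where "f \<in> I \<rightarrow>\<^sub>E S" "i \<in> I" "j \<in> I" "f i \<noteq> f j"
    by (auto simp: nonconst_def)
  then show thesis using that PiE_mem by metis
qed

lemma nonconst_restrict:
  assumes "f \<in> nonconst I S" "f ` I \<subseteq> T"
  shows "f \<in> nonconst I T"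
  using assms by (simp add: nonconst_def PiE_def Pi_def image_subset_iff)

lemma nonconst_Int: "nonconst I (S \<inter> T) = nonconst I S \<inter> nonconst I T"
  unfolding nonconst_def PiE_Int[symmetric] by blast

lemma finite_nonconst: "finite I \<Longrightarrow> finite S \<Longrightarrow> finite (nonconst I S)"
  unfolding nonconst_def by (rule finite_subset[of _ "I \<rightarrow>\<^sub>E S"]) (auto intro: finite_PiE)

lemma inj_on_const_tuple:
  assumes "I \<noteq> {}"
  shows "inj_on (\<lambda>c. \<lambda>i\<in>I. c) S"
proof (rule inj_onI)
  fix c d assume eq: "(\<lambda>i\<in>I. c) = (\<lambda>i\<in>I. d)"
  obtain i where "i \<in> I" using assms by auto
  then show "c = d" using fun_cong[OF eq, of i] by simp
qed

lemma funcset_eq_const_Un_nonconst: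
  assumes "I \<noteq> {}"
  shows "I \<rightarrow>\<^sub>E S = (\<lambda>c. \<lambda>i\<in>I. c) ` S \<union> nonconst I S"
proof -
  obtain i0 where i0: "i0 \<in> I" using assms by auto
  have "f \<in> (\<lambda>c. \<lambda>i\<in>I. c) ` S" if f: "f \<in> I \<rightarrow>\<^sub>E S" "f \<notin> nonconst I S" for f
  proof (rule image_eqI)
    show "f i0 \<in> S" using f i0 by auto
    show "f = (\<lambda>i\<in>I. f i0)"
    proof
      fix i
      have "f i = f i0" if "i \<in> I"
      proof (rule ccontr)
        assume "f i \<noteq> f i0"
        then have "f \<in> nonconst I S" using f(1) i0 that unfolding nonconst_def by simp metis
        then show False using f(2) by simp
      qed
      then show "f i = (\<lambda>i\<in>I. f i0) i" using PiE_arb[OF f(1), of i] by simp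
    qed
  qed
  moreover have "(\<lambda>c. \<lambda>i\<in>I. c) ` S \<subseteq> I \<rightarrow>\<^sub>E S" by auto
  moreover have "nonconst I S \<subseteq> I \<rightarrow>\<^sub>E S" by (simp add: nonconst_def)
  ultimately show ?thesis by blast
qed

lemma const_disjoint_nonconst: "(\<lambda>c. \<lambda>i\<in>I. c) ` S \<inter> nonconst I S' = {}"
  by (auto simp: nonconst_def)

lemma card_nonconst:
  assumes "finite I" "I \<noteq> {}" "finite S"
  shows "card (nonconst I S) + card S = card S ^ card I"
proof -
  have "card S ^ card I = card (I \<rightarrow>\<^sub>E S)"
    using assms by (simp add: card_funcsetE)
  also have "\<dots> = card ((\<lambda>c. \<lambda>i\<in>I. c) ` S) + card (nonconst I S)"
    unfolding funcset_eq_const_Un_nonconst[OF assms(2)]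
    by (rule card_Un_disjoint) (use assms in \<open>auto simp: finite_nonconst const_disjoint_nonconst\<close>)
  finally show ?thesis using assms by (simp add: card_image inj_on_const_tuple)
qed

section \<open>Families of pairwise close sets\<close>

text \<open>Let \<open>X \<noteq> Y\<close> be close. An element \<open>p\<close> of \<open>P\<close> outside \<open>X \<union> Y\<close> is the only one that \<open>P\<close> has beyond
  \<open>X\<close> and the only one beyond \<open>Y\<close>. So \<open>P\<close> misses every element of the symmetric difference of \<open>X\<close> and
  \<open>Y\<close>, and missing an element of \<open>X \<inter> Y\<close> too would make two in \<open>X\<close> or in \<open>Y\<close>. If instead
  \<open>P \<subseteq> X \<union> Y\<close> misses two elements of \<open>X \<union> Y\<close>, one is in \<open>X - Y\<close> and the other in \<open>Y - X\<close>; these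
  differences are singletons, so \<open>P = X \<inter> Y\<close>.\<close>

lemma close_to_both_star_or_costar:
  assumes PX: "almost_subset P X" "almost_subset X P" and PY: "almost_subset P Y" "almost_subset Y P"
    and XY: "almost_subset X Y" "almost_subset Y X" and "X \<noteq> Y"
  shows "(X \<inter> Y \<subseteq> P \<and> almost_subset P (X \<inter> Y)) \<or> (P \<subseteq> X \<union> Y \<and> almost_subset (X \<union> Y) P)"
proof (cases "P \<subseteq> X \<union> Y")
  case False
  then obtain p where p: "p \<in> P" "p \<notin> X" "p \<notin> Y" by auto
  have X: "a = p" if "a \<in> P" "a \<notin> X" for a using almost_subsetD[OF PX(1)] that p by metis
  have Y: "a = p" if "a \<in> P" "a \<notin> Y" for a using almost_subsetD[OF PY(1)] that p by metis
  have "almost_subset P (X \<inter> Y)" using X Y by (intro almost_subsetI) (metis IntI)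
  moreover have "m \<in> P" if m: "m \<in> X" "m \<in> Y" for m
  proof (rule ccontr)
    assume "m \<notin> P"
    obtain x where "x \<in> X \<and> x \<notin> Y \<or> x \<in> Y \<and> x \<notin> X" using \<open>X \<noteq> Y\<close> by blast
    then show False
      using X[of x] Y[of x] p m \<open>m \<notin> P\<close> almost_subsetD[OF PX(2), of x m] almost_subsetD[OF PY(2), of x m]
      by metis
  qed
  ultimately show ?thesis by auto
next
  case True
  show ?thesis
  proof (cases "almost_subset (X \<union> Y) P")
    case False
    then obtain a b where ab: "a \<in> X \<union> Y" "b \<in> X \<union> Y" "a \<notin> P" "b \<notin> P" "a \<noteq> b"
      unfolding almost_subset_def by auto
    then obtain c d where c: "c \<in> X" "c \<notin> Y" "c \<notin> P" and d: "d \<in> Y" "d \<notin> X" "d \<notin> P"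
      using almost_subsetD[OF PX(2), of a b] almost_subsetD[OF PY(2), of a b] by (metis UnE)
    have X: "m = c" if "m \<in> X" "m \<notin> P" for m using almost_subsetD[OF PX(2)] that c by metis
    have Y: "m = d" if "m \<in> Y" "m \<notin> P" for m using almost_subsetD[OF PY(2)] that d by metis
    have "X \<inter> Y \<subseteq> P" using X Y c d by (metis IntE subsetI)
    moreover have "almost_subset P (X \<inter> Y)"
    proof (rule almost_subsetI)
      fix a b assume "a \<in> P" "a \<notin> X \<inter> Y"
      then have False
        using True c d almost_subsetD[OF XY(1), of a c] almost_subsetD[OF XY(2), of a d]
        by (metis IntI UnE subsetD)
      then show "a = b" ..
    qed
    ultimately show ?thesis by simp
  qed (use True in simp)
qed

text \<open>The alternative of the previous lemma is the same for all members of a family of close sets: \<open>Z\<close>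
  lies on the costar side and \<open>W\<close> on the star side, and closeness of \<open>Z\<close> to \<open>W\<close> allows one of them
  to change side. If \<open>W\<close> has an element outside \<open>X \<union> Y\<close>, it is the only element of \<open>W\<close> missing from
  \<open>Z\<close>, hence \<open>Z\<close> contains \<open>X \<inter> Y\<close>, and every element of \<open>Z\<close> beyond \<open>X \<inter> Y\<close> is missing from \<open>W\<close>,
  so there is at most one. If \<open>W \<subseteq> X \<union> Y\<close> misses two elements of \<open>X \<union> Y\<close>, then \<open>W\<close> equals \<open>X \<inter> Y\<close>,
  so \<open>Z\<close> has at most one element beyond \<open>X \<inter> Y\<close>; it already misses one of the two, so it cannot
  also miss an element of \<open>X \<inter> Y\<close>.\<close>

lemma star_or_costar_uniform:
  assumes ZW: "almost_subset Z W" "almost_subset W Z" and XY: "almost_subset X Y" "almost_subset Y X"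
    and Z: "Z \<subseteq> X \<union> Y" "almost_subset (X \<union> Y) Z"
    and W: "X \<inter> Y \<subseteq> W" "almost_subset W (X \<inter> Y)"
  shows "(X \<inter> Y \<subseteq> Z \<and> almost_subset Z (X \<inter> Y)) \<or> (W \<subseteq> X \<union> Y \<and> almost_subset (X \<union> Y) W)"
proof (rule ccontr)
  assume contra: "\<not> ?thesis"
  show False
  proof (cases "W \<subseteq> X \<union> Y")
    case True
    with contra obtain a b where ab: "a \<in> X \<union> Y" "b \<in> X \<union> Y" "a \<notin> W" "b \<notin> W" "a \<noteq> b"
      unfolding almost_subset_def by auto
    have WD: "W \<subseteq> X \<inter> Y"
    proof
      fix w assume w: "w \<in> W"
      show "w \<in> X \<inter> Y"
      proof (rule ccontr)
        assume "w \<notin> X \<inter> Y"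
        then show False
          using ab w True W(1) almost_subsetD[OF XY(1), of a b] almost_subsetD[OF XY(2), of a b]
            almost_subsetD[OF XY(1), of w a] almost_subsetD[OF XY(2), of w a]
            almost_subsetD[OF XY(1), of w b] almost_subsetD[OF XY(2), of w b]
          by (metis IntI UnE subsetD)
      qed
    qed
    then have "W = X \<inter> Y" using W(1) by (rule subset_antisym)
    then obtain m where m: "m \<in> X \<inter> Y" "m \<notin> Z" using contra ZW(1) by auto
    obtain c where "c \<in> X \<union> Y" "c \<notin> Z" "c \<notin> W"
      using ab almost_subsetD[OF ZW(1), of a b] by metis
    then show False using almost_subsetD[OF Z(2), of m c] m W(1) by (metis IntD1 UnI1 subsetD)
  next
    case False
    then obtain w where w: "w \<in> W" "w \<notin> X \<union> Y" by auto
    then have wZ: "w \<notin> Z" using Z(1) by auto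
    have D: "u = w" if "u \<in> W" "u \<notin> X \<inter> Y" for u
      using almost_subsetD[OF W(2), of u w] that w by (metis IntD1 UnI1)
    have "X \<inter> Y \<subseteq> Z"
      using almost_subsetD[OF ZW(2), of _ w] w wZ W(1) by (metis IntD1 UnI1 subsetD subsetI)
    moreover have "almost_subset Z (X \<inter> Y)"
      using D wZ almost_subsetD[OF ZW(1)] by (intro almost_subsetI) metis
    ultimately show False using contra by simp
  qed
qed

lemma close_in_star_or_costar:
  assumes sub: "\<And>X Y. X \<in> F \<Longrightarrow> Y \<in> F \<Longrightarrow> almost_subset X Y"
    and V: "F \<subseteq> Pow V" and XY: "X \<in> F" "Y \<in> F" "X \<noteq> Y"
  shows "F \<subseteq> star V (X \<inter> Y) \<or> F \<subseteq> costar (X \<union> Y)"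
proof (rule ccontr)
  assume "\<not> ?thesis"
  then obtain Z W where ZW: "Z \<in> F" "W \<in> F" "Z \<notin> star V (X \<inter> Y)" "W \<notin> costar (X \<union> Y)"
    by blast
  have each: "P \<in> star V (X \<inter> Y) \<or> P \<in> costar (X \<union> Y)" if "P \<in> F" for P
    using close_to_both_star_or_costar[of P X Y] sub XY V that by (auto simp: star_def costar_def)
  have "Z \<in> costar (X \<union> Y)" "W \<in> star V (X \<inter> Y)" using each ZW by auto
  then show False
    using star_or_costar_uniform[of Z W X Y] ZW sub XY V by (auto simp: star_def costar_def)
qed

section \<open>Members of a star or a costar\<close>

lemma star_eq:
  assumes "A \<subseteq> V"
  shows "star V A = insert A ((\<lambda>x. insert x A) ` (V - A))"
proof (intro equalityI subsetI)
  fix Z assume "Z \<in> star V A"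
  then have Z: "A \<subseteq> Z" "Z \<subseteq> V" "almost_subset Z A" by (auto simp: star_def)
  show "Z \<in> insert A ((\<lambda>x. insert x A) ` (V - A))"
  proof (cases "Z = A")
    case False
    then obtain x where x: "x \<in> Z" "x \<notin> A" using Z by auto
    have "a \<in> insert x A" if "a \<in> Z" for a
      using almost_subsetD[OF Z(3) that _ x] by auto
    then have "Z = insert x A" using Z x by auto
    then show ?thesis using x Z by auto
  qed simp
qed (use assms in \<open>auto simp: star_def almost_subset_def\<close>)

lemma costar_eq: "costar B = insert B ((\<lambda>x. B - {x}) ` B)"
proof (intro equalityI subsetI)
  fix Z assume "Z \<in> costar B"
  then have Z: "Z \<subseteq> B" "almost_subset B Z" by (auto simp: costar_def)
  show "Z \<in> insert B ((\<lambda>x. B - {x}) ` B)"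
  proof (cases "Z = B")
    case False
    then obtain x where x: "x \<in> B" "x \<notin> Z" using Z by auto
    have "a \<in> Z" if "a \<in> B" "a \<noteq> x" for a
      using almost_subsetD[OF Z(2) that(1) _ x] that by auto
    then have "Z = B - {x}" using Z x by auto
    then show ?thesis using x by auto
  qed simp
qed (auto simp: costar_def almost_subset_def)

lemma star_Int:
  assumes "Z \<in> star V A" "W \<in> star V A" "Z \<noteq> W"
  shows "A = Z \<inter> W"
proof -
  have "A \<subseteq> V" using assms(1) by (auto simp: star_def)
  then obtain x y where "Z = A \<or> Z = insert x A" "W = A \<or> W = insert y A"
    using assms(1,2) by (auto simp: star_eq)
  then show ?thesis using assms(3) by (elim disjE; simp; fast)
qed

lemma costar_Un:
  assumes "Z \<in> costar B" "W \<in> costar B" "Z \<noteq> W"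
  shows "B = Z \<union> W"
proof -
  obtain x y where "Z = B \<or> Z = B - {x}" "W = B \<or> W = B - {y}"
    using assms(1,2) by (auto simp: costar_eq)
  then show ?thesis using assms(3) by (elim disjE; simp; fast)
qed

lemma star_close:
  assumes "X \<in> star V A" "Y \<in> star V A"
  shows "almost_subset X Y"
proof -
  have "almost_subset X A" "A \<subseteq> Y" using assms by (simp_all add: star_def)
  then show ?thesis using almost_subsetD[of X A] by (intro almost_subsetI) (metis subsetD)
qed

lemma costar_close:
  assumes "X \<in> costar B" "Y \<in> costar B"
  shows "almost_subset X Y"
proof -
  have "X \<subseteq> B" "almost_subset B Y" using assms by (simp_all add: costar_def)
  then show ?thesis using almost_subsetD[of B Y] by (intro almost_subsetI) (metis subsetD)
qed

lemma card_star:
  assumes "finite V" "A \<subseteq> V"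
  shows "card (star V A) = Suc (card (V - A))"
proof -
  have "inj_on (\<lambda>x. insert x A) (V - A)" by (rule inj_onI) blast
  moreover have "A \<notin> (\<lambda>x. insert x A) ` (V - A)" by blast
  ultimately show ?thesis using assms by (simp add: star_eq card_image)
qed

lemma card_costar:
  assumes "finite B"
  shows "card (costar B) = Suc (card B)"
proof -
  have "inj_on (\<lambda>x. B - {x}) B" by (rule inj_onI) blast
  moreover have "B \<notin> (\<lambda>x. B - {x}) ` B" by blast
  ultimately show ?thesis using assms by (simp add: costar_eq card_image)
qed

lemma finite_star: "finite V \<Longrightarrow> finite (star V A)"
  by (rule finite_subset[of _ "Pow V"]) (auto simp: star_def)

lemma finite_costar: "finite B \<Longrightarrow> finite (costar B)"
  by (rule finite_subset[of _ "Pow B"]) (auto simp: costar_def)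

section \<open>Decomposition of the close tuples\<close>

lemma close_tuples_eq:
  assumes "I \<noteq> {}"
  shows "close_tuples I V = (\<lambda>c. \<lambda>i\<in>I. c) ` Pow V
     \<union> ((\<Union>A\<in>Pow V. nonconst I (star V A)) \<union> (\<Union>B\<in>Pow V. nonconst I (costar B)))"
    (is "_ = ?C \<union> (?S \<union> ?T)")
proof (intro equalityI subsetI)
  fix f assume f: "f \<in> close_tuples I V"
  then have fV: "f \<in> I \<rightarrow>\<^sub>E Pow V"
    and cl: "\<And>i j. i \<in> I \<Longrightarrow> j \<in> I \<Longrightarrow> almost_subset (f i) (f j)"
    by (auto simp: close_tuples_def)
  show "f \<in> ?C \<union> (?S \<union> ?T)"
  proof (cases "f \<in> nonconst I (Pow V)")
    case False
    moreover have "f \<in> ?C \<union> nonconst I (Pow V)"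
      using fV unfolding funcset_eq_const_Un_nonconst[OF assms] .
    ultimately show ?thesis by simp
  next
    case True
    then obtain i j where ij: "i \<in> I" "j \<in> I" "f i \<noteq> f j" by (rule nonconstE)
    have V: "f ` I \<subseteq> Pow V" using fV by (simp add: PiE_def Pi_def image_subset_iff)
    have "f ` I \<subseteq> star V (f i \<inter> f j) \<or> f ` I \<subseteq> costar (f i \<union> f j)"
    proof (rule close_in_star_or_costar)
      fix X Y assume "X \<in> f ` I" "Y \<in> f ` I"
      then show "almost_subset X Y" using cl by (elim imageE) simp
    qed (use V ij in simp_all)
    then have "f \<in> nonconst I (star V (f i \<inter> f j)) \<or> f \<in> nonconst I (costar (f i \<union> f j))"
      using nonconst_restrict[OF True] by metis
    moreover have "f i \<inter> f j \<in> Pow V" "f i \<union> f j \<in> Pow V" using V ij by auto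
    ultimately show ?thesis by (meson UN_I UnI1 UnI2)
  qed
next
  have close: "f \<in> close_tuples I V"
    if "f \<in> nonconst I S" "S \<subseteq> Pow V" "\<And>X Y. X \<in> S \<Longrightarrow> Y \<in> S \<Longrightarrow> almost_subset X Y" for f S
  proof -
    from that(1) have f: "f \<in> I \<rightarrow>\<^sub>E S" by (rule nonconstE)
    then have "f \<in> I \<rightarrow>\<^sub>E Pow V" using PiE_mono[of I "\<lambda>_. S" "\<lambda>_. Pow V"] that(2) by blast
    then show ?thesis using that(3) PiE_mem[OF f] by (simp add: close_tuples_def)
  qed
  fix f assume "f \<in> ?C \<union> (?S \<union> ?T)"
  then consider "f \<in> ?C" | "f \<in> ?S" | "f \<in> ?T" by blast
  then show "f \<in> close_tuples I V"
  proof cases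
    case 1 then show ?thesis by (auto simp: close_tuples_def almost_subset_def)
  next
    case 2
    then obtain A where A: "f \<in> nonconst I (star V A)" by (rule UN_E)
    then show ?thesis by (rule close) (simp_all add: star_close, simp add: star_def subset_iff)
  next
    case 3
    then obtain B where B: "f \<in> nonconst I (costar B)" "B \<in> Pow V" by (rule UN_E)
    then have "costar B \<subseteq> Pow V" by (auto simp: costar_def)
    with B(1) show ?thesis by (rule close) (rule costar_close)
  qed
qed

section \<open>Overlaps of stars and costars\<close>

text \<open>The two common members are \<open>A\<close> and \<open>B = A \<union> D\<close> themselves when \<open>\<bar>D\<bar> = 1\<close>, and the two sets strictly
  between them when \<open>\<bar>D\<bar> = 2\<close>.\<close>

lemma card_star_Int_costar:
  assumes "D \<subseteq> V" "A \<subseteq> V - D" "card D = 1 \<or> card D = 2"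
  shows "card (star V A \<inter> costar (A \<union> D)) = 2"
  using assms(3)
proof
  have A: "A \<subseteq> V" using assms(2) by auto
  {
    assume "card D = 1"
    then obtain x where D: "D = {x}" by (auto simp: card_1_singleton_iff)
    then have x: "x \<in> V" "x \<notin> A" using assms by auto
    have "star V A \<inter> costar (A \<union> D) = {A, insert x A}"
      unfolding star_eq[OF A] costar_eq D using x by auto
    moreover have "A \<noteq> insert x A" using x by auto
    ultimately show ?thesis by simp
  next
    assume "card D = 2"
    then obtain x y where D: "D = {x, y}" "x \<noteq> y" by (auto simp: card_2_iff)
    then have x: "x \<in> V" "x \<notin> A" "y \<in> V" "y \<notin> A" using assms by auto
    have "star V A \<inter> costar (A \<union> D) = {insert x A, insert y A}"
      unfolding star_eq[OF A] costar_eq D using x D(2) by auto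
    moreover have "insert y A \<noteq> insert x A" using x D by auto
    ultimately show ?thesis by simp
  }
qed

text \<open>If the nonconstant tuple \<open>f\<close> lies in the star of \<open>A\<close> and in the costar of \<open>B\<close>, two of its distinct entries
  have intersection \<open>A\<close> and union \<open>B\<close>. So \<open>B - A\<close> is the symmetric difference of two close sets, which
  has one or two elements.\<close>

lemma nonconst_star_costar_eq:
  "(\<Union>A\<in>Pow V. nonconst I (star V A)) \<inter> (\<Union>B\<in>Pow V. nonconst I (costar B))
   = (\<Union>(D, A)\<in>(SIGMA D:{D. D \<subseteq> V \<and> (card D = 1 \<or> card D = 2)}. Pow (V - D)).
        nonconst I (star V A \<inter> costar (A \<union> D)))" (is "?L = ?R")
proof (intro equalityI subsetI)
  fix f assume "f \<in> ?L"
  then obtain A B where f: "f \<in> nonconst I (star V A \<inter> costar B)"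
    and AB: "A \<subseteq> V" "B \<subseteq> V" by (auto simp: nonconst_Int)
  from f obtain i j where ij: "f i \<in> star V A \<inter> costar B" "f j \<in> star V A \<inter> costar B" "f i \<noteq> f j"
    by (rule nonconstE)
  have A: "A = f i \<inter> f j" and B: "B = f i \<union> f j"
    using star_Int[of "f i" V A "f j"] costar_Un[of "f i" B "f j"] ij by auto
  define D where "D = B - A"
  have "almost_subset (f i) (f j)" "almost_subset (f j) (f i)"
    using ij star_close by blast+
  moreover have "\<exists>x. X - Y \<subseteq> {x}" if "almost_subset X Y" for X Y :: "'b set"
    using almost_subsetD[OF that] by (metis DiffE insertI1 subsetI)
  ultimately obtain x y where "f i - f j \<subseteq> {x}" "f j - f i \<subseteq> {y}" by metis
  then have xy: "D \<subseteq> {x, y}" unfolding D_def A B by blast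
  then have fin: "finite D" by (rule finite_subset) simp
  have "card D \<le> card {x, y}" using xy by (intro card_mono) auto
  also have "\<dots> \<le> 2" by (simp add: card_insert_if)
  finally have "card D \<le> 2" .
  moreover have "D \<noteq> {}" using ij(3) unfolding D_def A B by blast
  then have "card D \<noteq> 0" using fin by simp
  ultimately have "card D = 1 \<or> card D = 2" by linarith
  moreover have "A \<union> D = B" unfolding D_def A B by blast
  moreover have "D \<subseteq> V" "A \<subseteq> V - D" using AB unfolding D_def by auto
  ultimately show "f \<in> ?R" using f by (intro UN_I[of "(D, A)"]) auto
next
  fix f assume "f \<in> ?R"
  then obtain D A where "f \<in> nonconst I (star V A \<inter> costar (A \<union> D))" "D \<subseteq> V" "A \<subseteq> V"
    by auto
  then have "f \<in> nonconst I (star V A)" "f \<in> nonconst I (costar (A \<union> D))" "A \<in> Pow V" "A \<union> D \<in> Pow V"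
    by (auto simp: nonconst_Int)
  then show "f \<in> ?L" by blast
qed

lemma nonconst_star_unique:
  assumes "f \<in> nonconst I (star V A)" "f \<in> nonconst I (star V A')"
  shows "A = A'"
proof -
  from assms have "f \<in> nonconst I (star V A \<inter> star V A')" by (simp add: nonconst_Int)
  then obtain i j where "f i \<in> star V A \<inter> star V A'" "f j \<in> star V A \<inter> star V A'" "f i \<noteq> f j"
    by (rule nonconstE)
  then show ?thesis using star_Int by (metis IntD1 IntD2)
qed

lemma nonconst_costar_unique:
  assumes "f \<in> nonconst I (costar B)" "f \<in> nonconst I (costar B')"
  shows "B = B'"
proof -
  from assms have "f \<in> nonconst I (costar B \<inter> costar B')" by (simp add: nonconst_Int)
  then obtain i j where "f i \<in> costar B \<inter> costar B'" "f j \<in> costar B \<inter> costar B'" "f i \<noteq> f j"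
    by (rule nonconstE)
  then show ?thesis using costar_Un by (metis IntD1 IntD2)
qed

section \<open>Counting\<close>

lemma sum_Pow_card:
  fixes g :: "nat \<Rightarrow> nat"
  assumes "finite V"
  shows "(\<Sum>A\<in>Pow V. g (card A)) = (\<Sum>a\<le>card V. (card V choose a) * g a)"
proof -
  have "(\<Sum>A\<in>Pow V. g (card A)) = (\<Sum>a\<le>card V. \<Sum>A\<in>{A\<in>Pow V. card A = a}. g (card A))"
    by (rule sum.group[symmetric]) (use assms in \<open>auto intro: card_mono\<close>)
  also have "\<dots> = (\<Sum>a\<le>card V. (card V choose a) * g a)"
    using n_subsets[OF assms] by (intro sum.cong) auto
  finally show ?thesis .
qed

lemma sum_Pow_card_Diff:
  fixes g :: "nat \<Rightarrow> nat"
  shows "(\<Sum>A\<in>Pow V. g (card (V - A))) = (\<Sum>A\<in>Pow V. g (card A))"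
  by (rule sum.reindex_bij_witness[of _ "\<lambda>A. V - A" "\<lambda>A. V - A"])
     (auto simp: double_diff)

lemma sum_choose_Suc:
  "(\<Sum>a\<le>n. (n choose a) * Suc a) = 2 ^ n + n * 2 ^ (n - 1)"
  using choose_linear_sum[of n] choose_row_sum[of n] by (simp add: sum.distrib algebra_simps)

text \<open>These pairs index the overlapping stars and costars: \<open>(D, A)\<close> stands for the star of \<open>A\<close> and the
  costar of \<open>A \<union> D\<close>.\<close>

lemma card_star_costar_pairs:
  assumes "finite V"
  shows "card (SIGMA D:{D. D \<subseteq> V \<and> (card D = 1 \<or> card D = 2)}. Pow (V - D))
    = card V * 2 ^ (card V - 1) + (card V choose 2) * 2 ^ (card V - 2)"
proof -
  let ?S = "\<lambda>c. {D. D \<subseteq> V \<and> card D = c}"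
  have fin: "finite (?S c)" for c using assms by auto
  have split: "{D. D \<subseteq> V \<and> (card D = 1 \<or> card D = 2)} = ?S 1 \<union> ?S 2" by auto
  have c: "(\<Sum>D\<in>?S c. card (Pow (V - D))) = (card V choose c) * 2 ^ (card V - c)" for c
  proof -
    have "(\<Sum>D\<in>?S c. card (Pow (V - D))) = (\<Sum>D\<in>?S c. 2 ^ (card V - c))"
      using assms by (intro sum.cong) (auto simp: card_Pow card_Diff_subset finite_subset)
    then show ?thesis using n_subsets[OF assms] by simp
  qed
  have "card (SIGMA D:?S 1 \<union> ?S 2. Pow (V - D)) = (\<Sum>D\<in>?S 1 \<union> ?S 2. card (Pow (V - D)))"
    using assms by (intro card_SigmaI) auto
  also have "\<dots> = (\<Sum>D\<in>?S 1. card (Pow (V - D))) + (\<Sum>D\<in>?S 2. card (Pow (V - D)))"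
    using fin by (intro sum.union_disjoint) auto
  finally show ?thesis unfolding split c by simp
qed

text \<open>The form in which stars, costars and their overlaps are all counted: in each of the three families a
  nonconstant tuple determines the member containing it. Adding \<open>card (S p)\<close> on the left avoids truncated
  subtraction.\<close>

lemma card_UN_nonconst:
  assumes I: "finite I" "I \<noteq> {}" and E: "finite E" and S: "\<And>p. p \<in> E \<Longrightarrow> finite (S p)"
    and unique: "\<And>f p q. p \<in> E \<Longrightarrow> q \<in> E \<Longrightarrow> f \<in> nonconst I (S p) \<Longrightarrow> f \<in> nonconst I (S q) \<Longrightarrow> p = q"
  shows "card (\<Union>p\<in>E. nonconst I (S p)) + (\<Sum>p\<in>E. card (S p)) = (\<Sum>p\<in>E. card (S p) ^ card I)"
proof -
  have "card (\<Union>p\<in>E. nonconst I (S p)) = (\<Sum>p\<in>E. card (nonconst I (S p)))"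
  proof (rule card_UN_disjoint)
    show "\<forall>p\<in>E. \<forall>q\<in>E. p \<noteq> q \<longrightarrow> nonconst I (S p) \<inter> nonconst I (S q) = {}"
      using unique by (metis disjoint_iff)
  qed (use E I S finite_nonconst in auto)
  then have "card (\<Union>p\<in>E. nonconst I (S p)) + (\<Sum>p\<in>E. card (S p))
      = (\<Sum>p\<in>E. card (nonconst I (S p)) + card (S p))"
    by (simp only: sum.distrib)
  also have "\<dots> = (\<Sum>p\<in>E. card (S p) ^ card I)"
    using card_nonconst[OF I S] by (rule sum.cong[OF refl])
  finally show ?thesis .
qed

text \<open>Inclusion and exclusion for the nonconstant tuples in stars and those in costars, plus the constant
  tuples.\<close>

lemma card_close_tuples:
  assumes I: "finite I" "I \<noteq> {}" and V: "finite V" and n: "n = card V" and k: "k = card I"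
  shows "int (card (close_tuples I V)) = 2 ^ n
     + 2 * ((\<Sum>a\<le>n. int (n choose a) * (int a + 1) ^ k) - (2 ^ n + int n * 2 ^ (n - 1)))
     - (2 ^ k - 2) * (int n * 2 ^ (n - 1) + int (n choose 2) * 2 ^ (n - 2))"
proof -
  let ?C = "(\<lambda>c. \<lambda>i\<in>I. c) ` Pow V :: ('a \<Rightarrow> 'b set) set"
  let ?S = "\<Union>A\<in>Pow V. nonconst I (star V A)"
  let ?T = "\<Union>B\<in>Pow V. nonconst I (costar B)"
  let ?E = "SIGMA D:{D. D \<subseteq> V \<and> (card D = 1 \<or> card D = 2)}. Pow (V - D)"
  let ?m = "\<Sum>a\<le>n. (n choose a) * Suc a ^ k"
  have sub: "finite B" if "B \<in> Pow V" for B using V that by (auto intro: finite_subset)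
  have finP: "finite (Pow V)" using V by simp
  have finS: "finite ?S" using I(1) V by (intro finite_UN_I finP finite_nonconst finite_star)
  have finT: "finite ?T" using I(1) by (intro finite_UN_I finP finite_nonconst finite_costar sub)
  have C: "card ?C = 2 ^ n"
    using I V n by (simp add: card_image inj_on_const_tuple card_Pow)
  have lin: "(\<Sum>A\<in>Pow V. Suc (card A)) = 2 ^ n + n * 2 ^ (n - 1)"
    using sum_Pow_card[OF V, of Suc] sum_choose_Suc[of n] n by simp
  have pow: "(\<Sum>A\<in>Pow V. Suc (card A) ^ k) = ?m"
    using sum_Pow_card[OF V, of "\<lambda>c. Suc c ^ k"] n by simp
  have S: "int (card ?S) = int ?m - int (2 ^ n + n * 2 ^ (n - 1))"
  proof -
    have "card ?S + (\<Sum>A\<in>Pow V. card (star V A)) = (\<Sum>A\<in>Pow V. card (star V A) ^ card I)"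
      by (rule card_UN_nonconst[OF I finP finite_star[OF V] nonconst_star_unique])
    moreover have "(\<Sum>A\<in>Pow V. card (star V A)) = (\<Sum>A\<in>Pow V. Suc (card (V - A)))"
      using card_star[OF V] by (intro sum.cong) auto
    moreover have "(\<Sum>A\<in>Pow V. card (star V A) ^ card I) = (\<Sum>A\<in>Pow V. Suc (card (V - A)) ^ k)"
      using card_star[OF V] k by (intro sum.cong) auto
    ultimately have "card ?S + (2 ^ n + n * 2 ^ (n - 1)) = ?m"
      using sum_Pow_card_Diff[of Suc V] sum_Pow_card_Diff[of "\<lambda>c. Suc c ^ k" V] lin pow by metis
    then show ?thesis by linarith
  qed
  have T: "int (card ?T) = int ?m - int (2 ^ n + n * 2 ^ (n - 1))"
  proof -
    have "card ?T + (\<Sum>B\<in>Pow V. card (costar B)) = (\<Sum>B\<in>Pow V. card (costar B) ^ card I)"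
      by (rule card_UN_nonconst[OF I finP finite_costar[OF sub] nonconst_costar_unique])
    moreover have "(\<Sum>B\<in>Pow V. card (costar B)) = (\<Sum>B\<in>Pow V. Suc (card B))"
      by (intro sum.cong refl card_costar sub)
    moreover have "(\<Sum>B\<in>Pow V. card (costar B) ^ card I) = (\<Sum>B\<in>Pow V. Suc (card B) ^ k)"
      unfolding k by (intro sum.cong refl arg_cong[where f = "\<lambda>c. c ^ card I"] card_costar sub)
    ultimately have "card ?T + (2 ^ n + n * 2 ^ (n - 1)) = ?m"
      using lin pow by metis
    then show ?thesis by linarith
  qed
  have ST: "int (card (?S \<inter> ?T)) = (2 ^ k - 2) * (int n * 2 ^ (n - 1) + int (n choose 2) * 2 ^ (n - 2))"
  proof -
    let ?g = "\<lambda>p. star V (snd p) \<inter> costar (snd p \<union> fst p)"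
    have two: "card (?g p) = 2" if "p \<in> ?E" for p
      using that card_star_Int_costar[of "fst p" V "snd p"] by auto
    have "card (\<Union>p\<in>?E. nonconst I (?g p)) + (\<Sum>p\<in>?E. card (?g p)) = (\<Sum>p\<in>?E. card (?g p) ^ card I)"
    proof (rule card_UN_nonconst[OF I])
      show "finite ?E" using V by auto
      show "finite (?g p)" for p using finite_star[OF V] by simp
      fix f p q
      assume pq: "p \<in> ?E" "q \<in> ?E" and f: "f \<in> nonconst I (?g p)" "f \<in> nonconst I (?g q)"
      then have "snd p = snd q"
        using nonconst_star_unique[of f I V "snd p" "snd q"] by (simp add: nonconst_Int)
      moreover have "snd p \<union> fst p = snd q \<union> fst q"
        using f nonconst_costar_unique[of f I "snd p \<union> fst p" "snd q \<union> fst q"] by (simp add: nonconst_Int)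
      moreover have "snd p \<inter> fst p = {}" "snd q \<inter> fst q = {}" using pq by auto
      ultimately have "fst p = fst q" by blast
      with \<open>snd p = snd q\<close> show "p = q" by (rule prod_eqI[rotated])
    qed
    moreover have "?S \<inter> ?T = (\<Union>p\<in>?E. nonconst I (?g p))"
      unfolding nonconst_star_costar_eq by (intro SUP_cong refl) (simp add: case_prod_beta)
    moreover have "(\<Sum>p\<in>?E. card (?g p)) = card ?E * 2"
      using two by simp
    moreover have "(\<Sum>p\<in>?E. card (?g p) ^ card I) = card ?E * 2 ^ k"
      using two k by simp
    ultimately have "card (?S \<inter> ?T) + card ?E * 2 = card ?E * 2 ^ k"
      by metis
    then have "int (card (?S \<inter> ?T) + card ?E * 2) = int (card ?E * 2 ^ k)"
      by (simp only:)
    then have "int (card (?S \<inter> ?T)) = (2 ^ k - 2) * int (card ?E)"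
      by (simp only: of_nat_add of_nat_mult of_nat_numeral of_nat_power left_diff_distrib mult.commute)
    also have "int (card ?E) = int n * 2 ^ (n - 1) + int (n choose 2) * 2 ^ (n - 2)"
      unfolding card_star_costar_pairs[OF V] n by simp
    finally show ?thesis .
  qed
  have "card (close_tuples I V) = card ?C + card (?S \<union> ?T)"
    unfolding close_tuples_eq[OF I(2)]
  proof (rule card_Un_disjoint)
    show "?C \<inter> (?S \<union> ?T) = {}"
      by (simp only: Int_Un_distrib Int_UN_distrib const_disjoint_nonconst) simp
  qed (use finP finS finT in simp_all)
  moreover have "card ?S + card ?T = card (?S \<union> ?T) + card (?S \<inter> ?T)"
    by (rule card_Un_Int[OF finS finT])
  ultimately have "int (card (close_tuples I V)) = int (card ?C) + int (card ?S) + int (card ?T) - int (card (?S \<inter> ?T))"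
    by linarith
  moreover have "int ?m = (\<Sum>a\<le>n. int (n choose a) * (int a + 1) ^ k)"
    by (simp add: add.commute)
  ultimately show ?thesis unfolding C S T ST by simp
qed

section \<open>From matrices to tuples of sets\<close>

lemma submatrix_pair:
  assumes "i1 < i2" "i2 < dim_row A" "j1 < j2" "j2 < dim_col A"
  shows "submatrix A {i1, i2} {j1, j2}
    = mat_of_rows_list 2 [[A $$ (i1, j1), A $$ (i1, j2)], [A $$ (i2, j1), A $$ (i2, j2)]]"
proof -
  have pick_0: "pick {a, b} 0 = a" if "a < b" for a b :: nat
    unfolding pick.simps by (rule Least_equality) (use that in auto)
  have pick_1: "pick {a, b} (Suc 0) = b" if "a < b" for a b :: nat
    unfolding pick.simps(2) pick_0[OF that] by (rule Least_equality) (use that in auto)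
  have "{i. i < dim_row A \<and> i \<in> {i1, i2}} = {i1, i2}" "{j. j < dim_col A \<and> j \<in> {j1, j2}} = {j1, j2}"
    using assms by auto
  then have c: "card {i. i < dim_row A \<and> i \<in> {i1, i2}} = 2" "card {j. j < dim_col A \<and> j \<in> {j1, j2}} = 2"
    using assms by auto
  show ?thesis
    unfolding submatrix_def c
  proof (rule eq_matI)
    fix i j
    let ?B = "mat_of_rows_list 2 [[A $$ (i1, j1), A $$ (i1, j2)], [A $$ (i2, j1), A $$ (i2, j2)]]"
    assume "i < dim_row ?B" "j < dim_col ?B"
    then have "i = 0 \<or> i = Suc 0" "j = 0 \<or> j = Suc 0"
      by (auto simp: mat_of_rows_list_def)
    then show "mat 2 2 (\<lambda>(i, j). A $$ (pick {i1, i2} i, pick {j1, j2} j)) $$ (i, j) = ?B $$ (i, j)"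
      using pick_0 pick_1 assms
      by (elim disjE) (simp_all add: mat_of_rows_list_def del: pick.simps)
  qed (simp_all add: mat_of_rows_list_def)
qed

lemma mat_2_2_eq_iff:
  "mat_of_rows_list 2 [[a, b], [c, d]] = mat_of_rows_list 2 [[a', b'], [c', d']]
    \<longleftrightarrow> a = a' \<and> b = b' \<and> c = c' \<and> d = d'" (is "?M = ?M' \<longleftrightarrow> _")
proof
  assume eq: "?M = ?M'"
  have "?M $$ (i, j) = ?M' $$ (i, j)" for i j using eq by simp
  from this[of 0 0] this[of 0 1] this[of 1 0] this[of 1 1]
  show "a = a' \<and> b = b' \<and> c = c' \<and> d = d'" by (simp add: mat_of_rows_list_def)
qed simp

text \<open>The class of \<open>T\<close> contains both orders of the rows \<open>1 1\<close> and \<open>0 0\<close>, so the condition \<open>i1 < i2\<close> can be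
  dropped and a single pattern remains for all ordered pairs of rows.\<close>

lemma avoids_T_iff:
  assumes A: "A \<in> carrier_mat k n" and z: "zero_one_mat A"
  shows "avoids A T_mat \<longleftrightarrow>
    (\<forall>i<k. \<forall>i'<k. almost_subset {j\<in>{..<n}. A $$ (i, j) = 1} {j\<in>{..<n}. A $$ (i', j) = 1})"
proof -
  have z1: "A $$ (i, j) = 0 \<longleftrightarrow> A $$ (i, j) \<noteq> 1" if "i < k" "j < n" for i j
    using elements_matI[OF A that refl] z by (auto simp: zero_one_mat_def)
  have "avoids A T_mat \<longleftrightarrow> (\<forall>i1 i2 j1 j2. i1 < i2 \<and> i2 < k \<and> j1 < j2 \<and> j2 < n \<longrightarrow>
      \<not> (A $$ (i1, j1) = 1 \<and> A $$ (i1, j2) = 1 \<and> A $$ (i2, j1) = 0 \<and> A $$ (i2, j2) = 0) \<and>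
      \<not> (A $$ (i1, j1) = 0 \<and> A $$ (i1, j2) = 0 \<and> A $$ (i2, j1) = 1 \<and> A $$ (i2, j2) = 1))"
    using A unfolding avoids_def exchange_class_T
    by (intro iff_allI imp_cong) (auto simp: submatrix_pair mat_2_2_eq_iff)
  also have "\<dots> \<longleftrightarrow> (\<forall>i i' j j'. i < k \<and> i' < k \<and> j < j' \<and> j' < n \<longrightarrow>
      \<not> (A $$ (i, j) = 1 \<and> A $$ (i, j') = 1 \<and> A $$ (i', j) = 0 \<and> A $$ (i', j') = 0))"
    (is "?L \<longleftrightarrow> ?R")
  proof
    assume L: ?L
    show ?R
    proof (intro allI impI notI)
      fix i i' j j'
      assume h: "i < k \<and> i' < k \<and> j < j' \<and> j' < n"
        "A $$ (i, j) = 1 \<and> A $$ (i, j') = 1 \<and> A $$ (i', j) = 0 \<and> A $$ (i', j') = 0"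
      then have "i < i' \<or> i' < i" by (metis linorder_neqE_nat zero_neq_one)
      then show False using L h by blast
    qed
  next
    assume ?R
    then show ?L by (meson less_trans)
  qed
  also have "\<dots> \<longleftrightarrow> (\<forall>i<k. \<forall>i'<k. almost_subset {j\<in>{..<n}. A $$ (i, j) = 1} {j\<in>{..<n}. A $$ (i', j) = 1})"
    (is "_ \<longleftrightarrow> ?Q")
  proof
    assume R: ?R
    show ?Q
    proof (intro allI impI almost_subsetI)
      fix i i' a b assume i: "i < k" "i' < k"
        and "a \<in> {j\<in>{..<n}. A $$ (i, j) = 1}" "a \<notin> {j\<in>{..<n}. A $$ (i', j) = 1}"
          "b \<in> {j\<in>{..<n}. A $$ (i, j) = 1}" "b \<notin> {j\<in>{..<n}. A $$ (i', j) = 1}"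
      then have "a < n" "b < n" "A $$ (i, a) = 1" "A $$ (i', a) = 0" "A $$ (i, b) = 1" "A $$ (i', b) = 0"
        using z1 by auto
      then have "\<not> a < b" "\<not> b < a" using R i by blast+
      then show "a = b" by simp
    qed
  next
    assume Q: ?Q
    show ?R
    proof (intro allI impI notI)
      fix i i' j j'
      assume h: "i < k \<and> i' < k \<and> j < j' \<and> j' < n"
        "A $$ (i, j) = 1 \<and> A $$ (i, j') = 1 \<and> A $$ (i', j) = 0 \<and> A $$ (i', j') = 0"
      then have "j = j'"
        using almost_subsetD[OF Q[rule_format, of i i'], of j j'] by auto
      then show False using h by simp
    qed
  qed
  finally show ?thesis .
qed

lemma phi_T_eq_card_close_tuples: "phi k n T_mat = card (close_tuples {..<k} {..<n})"
proof -
  let ?rows = "\<lambda>A. \<lambda>i\<in>{..<k}. {j\<in>{..<n}. A $$ (i, j) = (1 :: int)}"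
  let ?mat = "\<lambda>f. mat k n (\<lambda>(i, j). if j \<in> f i then 1 else 0 :: int)"
  let ?M = "{A \<in> carrier_mat k n. zero_one_mat A \<and> avoids A T_mat}"
  have inv1: "?mat (?rows A) = A" if A: "A \<in> carrier_mat k n" "zero_one_mat A" for A
  proof (rule eq_matI)
    fix i j assume "i < dim_row A" "j < dim_col A"
    then have ij: "i < k" "j < n" using A by auto
    have "A $$ (i, j) \<in> {0, 1}"
      using elements_matI[OF A(1) ij refl] A(2) by (auto simp: zero_one_mat_def)
    then show "?mat (?rows A) $$ (i, j) = A $$ (i, j)" using ij by auto
  qed (use A in auto)
  have inv2: "?rows (?mat f) = f" if f: "f \<in> {..<k} \<rightarrow>\<^sub>E Pow {..<n}" for f
  proof
    fix i
    show "?rows (?mat f) i = f i"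
    proof (cases "i < k")
      case True
      then have "f i \<subseteq> {..<n}" using PiE_mem[OF f, of i] by simp
      then show ?thesis using True by (auto split: if_splits)
    next
      case False
      then show ?thesis using PiE_arb[OF f, of i] by simp
    qed
  qed
  have zo: "zero_one_mat (?mat f)" for f
    unfolding zero_one_mat_def by (auto dest!: elements_matD split: if_splits)
  have "bij_betw ?rows ?M (close_tuples {..<k} {..<n})"
  proof (rule bij_betw_byWitness[where f' = ?mat])
    show "\<forall>A\<in>?M. ?mat (?rows A) = A" using inv1 by blast
    show "\<forall>f\<in>close_tuples {..<k} {..<n}. ?rows (?mat f) = f"
    proof
      fix f :: "nat \<Rightarrow> nat set" assume "f \<in> close_tuples {..<k} {..<n}"
      then show "?rows (?mat f) = f" by (intro inv2) (simp add: close_tuples_def)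
    qed
    show "?rows ` ?M \<subseteq> close_tuples {..<k} {..<n}"
    proof (rule image_subsetI)
      fix A assume "A \<in> ?M"
      then have "\<forall>i<k. \<forall>i'<k. almost_subset {j\<in>{..<n}. A $$ (i, j) = 1} {j\<in>{..<n}. A $$ (i', j) = 1}"
        using avoids_T_iff by blast
      moreover have "?rows A \<in> {..<k} \<rightarrow>\<^sub>E Pow {..<n}" by (rule restrict_PiE[THEN iffD2]) blast
      ultimately show "?rows A \<in> close_tuples {..<k} {..<n}"
        by (simp add: close_tuples_def)
    qed
    show "?mat ` close_tuples {..<k} {..<n} \<subseteq> ?M"
    proof (rule image_subsetI)
      fix f assume f: "f \<in> close_tuples {..<k} {..<n}"
      then have eq: "?rows (?mat f) = f" by (intro inv2) (simp add: close_tuples_def)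
      have "{j\<in>{..<n}. ?mat f $$ (i, j) = 1} = f i" if "i < k" for i
        using fun_cong[OF eq, of i] that by simp
      then have "avoids (?mat f) T_mat"
        using f by (subst avoids_T_iff[OF mat_carrier zo]) (simp add: close_tuples_def)
      then show "?mat f \<in> ?M" using zo by simp
    qed
  qed
  then show ?thesis unfolding phi_def by (rule bij_betw_same_card)
qed

section \<open>The closed formula\<close>

lemma infsum_binomial_power_eq_sum:
  "(\<Sum>\<^sub>\<infinity>l\<in>{1..}. real (n choose (l - 1)) * real l ^ k) = (\<Sum>a\<le>n. real (n choose a) * (real a + 1) ^ k)"
proof -
  have "(\<Sum>\<^sub>\<infinity>l\<in>{1..}. real (n choose (l - 1)) * real l ^ k)
      = (\<Sum>\<^sub>\<infinity>l\<in>Suc ` {..n}. real (n choose (l - 1)) * real l ^ k)"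
  proof (rule infsum_cong_neutral)
    fix l assume l: "l \<in> {1..} - Suc ` {..n}"
    have "\<not> l - 1 \<le> n"
    proof
      assume "l - 1 \<le> n"
      then have "Suc (l - 1) \<in> Suc ` {..n}" by blast
      with l show False by simp
    qed
    then show "real (n choose (l - 1)) * real l ^ k = 0" by (simp add: binomial_eq_0)
  qed auto
  also have "\<dots> = (\<Sum>a\<le>n. real (n choose a) * (real a + 1) ^ k)"
    by (simp add: sum.reindex add.commute)
  finally show ?thesis .
qed

theorem theorem3p2:
  fixes k n :: nat
  assumes "k \<ge> 1" and "n \<ge> 1"
  shows "real (phi k n T_mat) =
    2 * (\<Sum>\<^sub>\<infinity>l\<in>{1..}. real (n choose (l - 1)) * real l ^ k)
    + ((real n)^2 - real n - 4) * 2 powi (int n - 2)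
    - real n * (real n + 3) * 2 powi (int n + int k - 3)"
proof -
  let ?s = "\<Sum>a\<le>n. real (n choose a) * (real a + 1) ^ k"
  have "real_of_int (int (phi k n T_mat)) = real_of_int (2 ^ n
     + 2 * ((\<Sum>a\<le>n. int (n choose a) * (int a + 1) ^ k) - (2 ^ n + int n * 2 ^ (n - 1)))
     - (2 ^ k - 2) * (int n * 2 ^ (n - 1) + int (n choose 2) * 2 ^ (n - 2)))"
    unfolding phi_T_eq_card_close_tuples using assms
    by (subst card_close_tuples[where n = n and k = k]) (auto simp: lessThan_empty_iff bot_nat_def)
  then have phi: "real (phi k n T_mat) = 2 ^ n + 2 * (?s - (2 ^ n + real n * 2 ^ (n - 1)))
     - (2 ^ k - 2) * (real n * 2 ^ (n - 1) + real (n choose 2) * 2 ^ (n - 2))"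
    by simp
  have p1: "(2::real) ^ (n - 1) = 2 ^ n / 2"
    using assms by (simp add: power_diff)
  \<comment> \<open>For \<open>n = 1\<close> the exponent \<open>n - 2\<close> is truncated, but both sides vanish.\<close>
  have p2: "real (n choose 2) * 2 ^ (n - 2) = real n * (real n - 1) * 2 ^ n / 8"
  proof (cases "n = 1")
    case False
    then have pow: "(2::real) ^ (n - 2) = 2 ^ n / 4" using assms by (simp add: power_diff)
    have choose: "real (n choose 2) = real n * (real n - 1) / 2"
      using assms by (simp add: choose_two real_of_nat_div of_nat_diff)
    show ?thesis unfolding pow choose by simp
  qed simp
  have p3: "2 powi (int n - 2) = (2::real) ^ n / 4"
    by (simp add: power_int_diff)
  have p4: "2 powi (int n + int k - 3) = (2::real) ^ n * 2 ^ k / 8"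
    by (simp add: power_int_diff power_int_add)
  show ?thesis
    unfolding infsum_binomial_power_eq_sum phi p1 p2 p3 p4 by (simp add: field_simps power2_eq_square)
qed

end
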